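(* Let $A$ be a $C^*$-algebra, $H$ a Hilbert $A$-module and $\xi\in H^\sharp$. Suppose there is a bounded net $\{x_\alpha\}$ in $H$ such that $\lim_\alpha\|\xi(x)-\langle x_\alpha,x\rangle\|=0$ for all $x\in H$ and such that $\xi(x_\alpha)$ converges in norm. Then there is $\eta\in H$ with $\xi=\langle\eta,\cdot\rangle$, and $\langle\eta,\eta\rangle=\lim_\alpha\xi(x_\alpha)\in A$.
   Context: Hilbert modules are right modules with $A$-valued inner product linear in the second variable; $H^\sharp$ is the space of bounded $A$-module maps $H\to A$. *)

theory Defs
  imports "HOL-Analysis.Analysis"
begin

text \<open>A C*-algebra (not necessarily unital) is modelled as a real Banach algebra
type 'a together with a complex scalar multiplication sc (extending the real one)
and an involution st, satisfying the usual axioms and the C*-identity.\<close>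

definition cstar_algebra ::
  "(complex \<Rightarrow> 'a::{real_normed_algebra,banach} \<Rightarrow> 'a) \<Rightarrow> ('a \<Rightarrow> 'a) \<Rightarrow> bool"
  where "cstar_algebra sc st \<longleftrightarrow>
     (\<forall>r a. sc (complex_of_real r) a = r *\<^sub>R a) \<and>
     (\<forall>c a b. sc c (a + b) = sc c a + sc c b) \<and>
     (\<forall>c d a. sc (c + d) a = sc c a + sc d a) \<and>
     (\<forall>c d a. sc (c * d) a = sc c (sc d a)) \<and>
     (\<forall>a. sc 1 a = a) \<and>
     (\<forall>c a b. sc c (a * b) = sc c a * b \<and> sc c (a * b) = a * sc c b) \<and>
     (\<forall>c a. norm (sc c a) = cmod c * norm a) \<and>
     (\<forall>a b. st (a + b) = st a + st b) \<and>
     (\<forall>c a. st (sc c a) = sc (cnj c) (st a)) \<and>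
     (\<forall>a b. st (a * b) = st b * st a) \<and>
     (\<forall>a. st (st a) = a) \<and>
     (\<forall>a. norm (st a * a) = (norm a)\<^sup>2)"

text \<open>Positive elements: those of the form b* b (a standard equivalent
characterisation of positivity in a C*-algebra).\<close>

definition cstar_positive :: "('a \<Rightarrow> 'a) \<Rightarrow> 'a::ring \<Rightarrow> bool"
  where "cstar_positive st a \<longleftrightarrow> (\<exists>b. a = st b * b)"

text \<open>A (right) Hilbert A-module: a type 'h which is a real Banach space, with a
complex scalar multiplication scH (extending the real one), a right A-action ra,
and an A-valued inner product ip, linear in the second variable, whose induced norm
sqrt (norm (ip x x)) is the norm of 'h (so 'h is complete for it).\<close>

definition hilbert_module ::
  "(complex \<Rightarrow> 'a::{real_normed_algebra,banach} \<Rightarrow> 'a) \<Rightarrow> ('a \<Rightarrow> 'a) \<Rightarrow>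
   (complex \<Rightarrow> 'h::banach \<Rightarrow> 'h) \<Rightarrow> ('h \<Rightarrow> 'a \<Rightarrow> 'h) \<Rightarrow> ('h \<Rightarrow> 'h \<Rightarrow> 'a) \<Rightarrow> bool"
  where "hilbert_module sc st scH ra ip \<longleftrightarrow>
     cstar_algebra sc st \<and>
     (\<forall>r x. scH (complex_of_real r) x = r *\<^sub>R x) \<and>
     (\<forall>c x y. scH c (x + y) = scH c x + scH c y) \<and>
     (\<forall>c d x. scH (c + d) x = scH c x + scH d x) \<and>
     (\<forall>c d x. scH (c * d) x = scH c (scH d x)) \<and>
     (\<forall>x. scH 1 x = x) \<and>
     (\<forall>x y a. ra (x + y) a = ra x a + ra y a) \<and>
     (\<forall>x a b. ra x (a + b) = ra x a + ra x b) \<and>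
     (\<forall>x a b. ra x (a * b) = ra (ra x a) b) \<and>
     (\<forall>c x a. scH c (ra x a) = ra (scH c x) a \<and> scH c (ra x a) = ra x (sc c a)) \<and>
     (\<forall>x y z. ip x (y + z) = ip x y + ip x z) \<and>
     (\<forall>c x y. ip x (scH c y) = sc c (ip x y)) \<and>
     (\<forall>x y a. ip x (ra y a) = ip x y * a) \<and>
     (\<forall>x y. st (ip x y) = ip y x) \<and>
     (\<forall>x. cstar_positive st (ip x x)) \<and>
     (\<forall>x. ip x x = 0 \<longrightarrow> x = 0) \<and>
     (\<forall>x. norm x = sqrt (norm (ip x x)))"

definition hilbert_sharp ::
  "(complex \<Rightarrow> 'a::real_normed_algebra \<Rightarrow> 'a) \<Rightarrow> (complex \<Rightarrow> 'h::real_normed_vector \<Rightarrow> 'h) \<Rightarrow> ('h \<Rightarrow> 'a \<Rightarrow> 'h) \<Rightarrow>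
   ('h \<Rightarrow> 'a) \<Rightarrow> bool"
  where "hilbert_sharp sc scH ra \<xi> \<longleftrightarrow>
     (\<forall>x y. \<xi> (x + y) = \<xi> x + \<xi> y) \<and>
     (\<forall>c x. \<xi> (scH c x) = sc c (\<xi> x)) \<and>
     (\<forall>x a. \<xi> (ra x a) = \<xi> x * a) \<and>
     (\<exists>K. \<forall>x. norm (\<xi> x) \<le> K * norm x)"

definition directed :: "'i::preorder itself \<Rightarrow> bool"
  where "directed _ \<longleftrightarrow> (\<forall>a b::'i. \<exists>c. a \<le> c \<and> b \<le> c)"

definition net_filter :: "('i::preorder) filter"
  where "net_filter = (INF k. principal {j. k \<le> j})"

end

theory Submission
  imports Defs
begin

text \<open>
  Let \<open>L\<close> be the limit of \<open>\<xi> (x\<^sub>\<alpha>)\<close>. The idea is a Banach--Saks averaging argument. Choose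
  successively members \<open>z\<^sub>0, z\<^sub>1, \<dots>\<close> of the net, each so late that \<open>\<langle>z\<^sub>i, z\<^sub>j\<rangle>\<close> is close to \<open>\<xi> (z\<^sub>j)\<close>,
  hence to \<open>L\<close>, for all \<open>j < i\<close>. A long average \<open>y\<close> of these satisfies \<open>\<langle>y, y\<rangle> \<approx> (L + L\<^sup>*) / 2\<close> and
  \<open>\<xi> (y) \<approx> L\<close>, since the diagonal terms become negligible. If \<open>y'\<close> is another such average, taken
  from a tail so late that \<open>\<langle>y', y\<rangle> \<approx> \<xi> (y) \<approx> L\<close>, then expanding \<open>\<langle>y - y', y - y'\<rangle>\<close> shows
  \<open>y \<approx> y'\<close>. Comparing two arbitrary averages with a third, later one, all of them are close to each
  other, so they converge to some \<open>\<eta>\<close>; as they can be taken from arbitrarily late tails,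
  \<open>\<langle>\<eta>, x\<rangle> = \<xi> (x)\<close> for all \<open>x\<close>.
\<close>

section \<open>Averages of a net under a Hermitian form\<close>

text \<open>Isolates the real-linear facts about an inner product on which averaging rests:
  boundedness lets limits pass through \<open>ip\<close>, and \<open>norm_ip_self\<close> turns
  estimates of \<open>ip\<close> on the diagonal into estimates of the norm.\<close>

locale hermitian_form = bounded_bilinear ip + st: bounded_linear st
  for ip :: "'h::banach \<Rightarrow> 'h \<Rightarrow> 'a::real_normed_vector" and st :: "'a \<Rightarrow> 'a" +
  assumes norm_st: "norm (st a) = norm a"
    and st_ip: "st (ip x y) = ip y x"
    and norm_ip_self: "norm (ip x x) = (norm x)\<^sup>2"
begin

text \<open>Passing from \<open>n\<close> to \<open>Suc n\<close> adds \<open>n\<close> products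
  near \<open>L\<close>, their \<open>n\<close> adjoints near \<open>st L\<close>, and one diagonal
  term: in total 2n+1 copies of half of \<open>L + st L\<close>, the increment of the square. The
  diagonal error \<open>real n * K\<close> is only linear, hence negligible after division by the
  square of \<open>n\<close>.\<close>

lemma sum_almost_self_product:
  assumes close: "\<And>i j. j < i \<Longrightarrow> norm (ip (z i) (z j) - L) \<le> e"
    and diag: "\<And>i. norm (ip (z i) (z i) - (1/2) *\<^sub>R (L + st L)) \<le> K"
  shows "norm (ip (\<Sum>i<n. z i) (\<Sum>i<n. z i) - (real n)\<^sup>2 *\<^sub>R (1/2) *\<^sub>R (L + st L))
           \<le> e * (real n)\<^sup>2 + real n * K"
proof (induction n)
  case 0
  then show ?case by (simp add: zero_left)
next
  case (Suc n)
  define s where "s = (\<Sum>i<n. z i)"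
  define R where "R = (1/2) *\<^sub>R (L + st L)"
  have e0: "0 \<le> e"
    using close[of 0 1] norm_ge_zero order_trans by (metis zero_less_one)
  have "ip (z n) s - real n *\<^sub>R L = (\<Sum>j<n. ip (z n) (z j) - L)"
    by (simp add: s_def sum_right sum_subtractf scaleR_conv_of_real sum_constant_scaleR)
  also have "norm \<dots> \<le> (\<Sum>j<n. e)"
    by (intro sum_norm_le) (auto intro: close)
  finally have d: "norm (ip (z n) s - real n *\<^sub>R L) \<le> real n * e"
    by simp
  have eq: "ip s (z n) - real n *\<^sub>R st L = st (ip (z n) s - real n *\<^sub>R L)"
    by (simp add: st.diff st.scaleR st_ip)
  have d': "norm (ip s (z n) - real n *\<^sub>R st L) \<le> real n * e"
    unfolding eq norm_st by (rule d)
  have twice: "(2 * real n) *\<^sub>R R = real n *\<^sub>R L + real n *\<^sub>R st L"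
    by (simp add: R_def scaleR_add_right)
  have sq: "(real (Suc n))\<^sup>2 *\<^sub>R R = (real n)\<^sup>2 *\<^sub>R R + (2 * real n) *\<^sub>R R + R"
  proof -
    have "(real (Suc n))\<^sup>2 = (real n)\<^sup>2 + 2 * real n + 1"
      by (simp add: power2_eq_square algebra_simps)
    then show ?thesis
      by (simp only: scaleR_add_left scaleR_one)
  qed
  have "ip (s + z n) (s + z n) - (real (Suc n))\<^sup>2 *\<^sub>R R
      = (ip s s - (real n)\<^sup>2 *\<^sub>R R) + (ip s (z n) - real n *\<^sub>R st L)
        + (ip (z n) s - real n *\<^sub>R L) + (ip (z n) (z n) - R)"
    unfolding sq twice by (simp add: add_left add_right)
  also have "norm \<dots> \<le> (e * (real n)\<^sup>2 + real n * K) + real n * e + real n * e + K"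
    using Suc.IH diag[of n] d d' unfolding s_def[symmetric] R_def[symmetric]
    by (intro norm_triangle_mono) auto
  also have "\<dots> \<le> e * (real (Suc n))\<^sup>2 + real (Suc n) * K"
    using e0 by (simp add: power2_eq_square algebra_simps)
  finally show ?case
    by (simp add: s_def R_def)
qed

text \<open>Each new member has to satisfy only finitely many eventual conditions, one per earlier
  member, so a suitable index exists. The bound \<open>2 * e\<close> is one \<open>e\<close> for the
  distance to \<open>\<xi> (z j)\<close> and one from there to \<open>L\<close>.\<close>

lemma exists_sequence_products_near_limit:
  assumes F: "F \<noteq> bot"
    and weak: "\<And>x. ((\<lambda>\<alpha>. ip (xn \<alpha>) x) \<longlongrightarrow> \<xi> x) F"
    and lim: "((\<lambda>\<alpha>. \<xi> (xn \<alpha>)) \<longlongrightarrow> L) F"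
    and P: "eventually P F" and e: "e > 0"
  shows "\<exists>z :: nat \<Rightarrow> 'h. \<forall>i. z i \<in> xn ` {\<alpha>. P \<alpha>} \<and> norm (\<xi> (z i) - L) \<le> e \<and>
              (\<forall>j<i. norm (ip (z i) (z j) - L) \<le> 2 * e)"
proof -
  define Q where "Q f i \<alpha> \<longleftrightarrow> P \<alpha> \<and> norm (\<xi> (xn \<alpha>) - L) < e \<and>
      (\<forall>j<i. norm (ip (xn \<alpha>) (xn (f j)) - \<xi> (xn (f j))) < e)" for f :: "nat \<Rightarrow> 'b" and i \<alpha>
  have "\<exists>f. \<forall>i. Q f i (f i)"
  \<comment> \<open>The condition on \<open>f i\<close> involves all earlier values of
    \<open>f\<close>, hence a choice along a well-founded relation.\<close>
  proof (rule dependent_wf_choice[where R = less_than])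
    show "wf less_than" by (rule wf_less_than)
    show "Q f x r = Q g x r" if "\<And>z. (z, x) \<in> less_than \<Longrightarrow> f z = g z" for f g x r
      using that by (auto simp: Q_def)
    fix i and f :: "nat \<Rightarrow> 'b"
    have "eventually (\<lambda>\<alpha>. \<forall>j\<in>{..<i}. norm (ip (xn \<alpha>) (xn (f j)) - \<xi> (xn (f j))) < e) F"
      using tendstoD[OF weak e] by (intro eventually_ball_finite) (auto simp: dist_norm)
    moreover have "eventually (\<lambda>\<alpha>. norm (\<xi> (xn \<alpha>) - L) < e) F"
      using tendstoD[OF lim e] by (simp add: dist_norm)
    ultimately have "eventually (\<lambda>\<alpha>. Q f i \<alpha>) F"
      using P by eventually_elim (auto simp: Q_def)
    then show "\<exists>\<alpha>. Q f i \<alpha>"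
      using F eventually_happens' by blast
  qed
  then obtain f where f: "Q f i (f i)" for i by blast
  have "norm (ip (xn (f i)) (xn (f j)) - L) \<le> 2 * e" if "j < i" for i j
    using f[of i] f[of j] that
      norm_triangle_ineq[of "ip (xn (f i)) (xn (f j)) - \<xi> (xn (f j))" "\<xi> (xn (f j)) - L"]
    by (fastforce simp: Q_def)
  moreover have "xn (f i) \<in> xn ` {\<alpha>. P \<alpha>}" "norm (\<xi> (xn (f i)) - L) \<le> e" for i
    using f[of i] by (auto simp: Q_def)
  ultimately show ?thesis
    by (intro exI[of _ "\<lambda>i. xn (f i)"]) blast
qed

lemma exists_average:
  assumes F: "F \<noteq> bot"
    and bdd: "\<And>\<alpha>. norm (xn \<alpha>) \<le> M"
    and \<xi>: "linear \<xi>"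
    and weak: "\<And>x. ((\<lambda>\<alpha>. ip (xn \<alpha>) x) \<longlongrightarrow> \<xi> x) F"
    and lim: "((\<lambda>\<alpha>. \<xi> (xn \<alpha>)) \<longlongrightarrow> L) F"
    and P: "eventually P F" and e: "e > 0"
  obtains y where "y \<in> convex hull (xn ` {\<alpha>. P \<alpha>})"
    "norm (ip y y - (1/2) *\<^sub>R (L + st L)) \<le> e" "norm (\<xi> y - L) \<le> e"
proof -
  define R where "R = (1/2) *\<^sub>R (L + st L)"
  define K where "K = M\<^sup>2 + norm R"
  have K0: "K \<ge> 0" by (simp add: K_def)
  \<comment> \<open>With \<open>e/4\<close> the off-diagonal products are off by at most
    \<open>e/2\<close>, which leaves \<open>e/2\<close> for the diagonal contribution
    \<open>K / real n\<close>.\<close>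
  from exists_sequence_products_near_limit[OF F weak lim P, of "e/4"] e
  obtain z :: "nat \<Rightarrow> 'h" where z: "\<And>i. z i \<in> xn ` {\<alpha>. P \<alpha>}" "\<And>i. norm (\<xi> (z i) - L) \<le> e/4"
    "\<And>i j. j < i \<Longrightarrow> norm (ip (z i) (z j) - L) \<le> 2 * (e/4)"
    by (metis divide_pos_pos zero_less_numeral)
  have diag: "norm (ip (z i) (z i) - R) \<le> K" for i
  proof -
    have "norm (z i) \<le> M" using z(1)[of i] bdd by auto
    then have "norm (ip (z i) (z i)) \<le> M\<^sup>2"
      unfolding norm_ip_self by (intro power_mono) auto
    then show ?thesis
      unfolding K_def by (intro order_trans[OF norm_triangle_ineq4]) auto
  qed
  obtain n :: nat where n: "n > 2 * K / e"
    using reals_Archimedean2 by blast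
  then have n0: "n > 0"
    using K0 e by (metis divide_nonneg_pos gr0I mult_nonneg_nonneg not_less of_nat_0 zero_le_numeral)
  have nK: "K / real n \<le> e / 2"
    using n n0 e by (simp add: field_simps)
  define s where "s = (\<Sum>i<n. z i)"
  define y where "y = (1 / real n) *\<^sub>R s"
  have "y = (\<Sum>i<n. (1 / real n) *\<^sub>R z i)"
    by (simp add: y_def s_def scaleR_sum_right)
  also have "\<dots> \<in> convex hull (xn ` {\<alpha>. P \<alpha>})"
    using n0 z(1) by (intro convex_sum) (auto intro: hull_inc)
  finally have "y \<in> convex hull (xn ` {\<alpha>. P \<alpha>})" .
  moreover have "norm (ip y y - R) \<le> e"
  proof -
    have "ip y y - R = (1 / (real n)\<^sup>2) *\<^sub>R (ip s s - (real n)\<^sup>2 *\<^sub>R R)"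
      using n0 by (simp add: y_def scaleR_left scaleR_right scaleR_diff_right power2_eq_square)
    also have "norm \<dots> = norm (ip s s - (real n)\<^sup>2 *\<^sub>R R) / (real n)\<^sup>2"
      by simp
    also have "\<dots> \<le> (2 * (e/4) * (real n)\<^sup>2 + real n * K) / (real n)\<^sup>2"
      unfolding s_def R_def
      by (intro divide_right_mono sum_almost_self_product z(3) diag[unfolded R_def]) auto
    also have "\<dots> = e / 2 + K / real n"
      using n0 by (simp add: power2_eq_square field_simps)
    also have "\<dots> \<le> e" using nK by linarith
    finally show ?thesis .
  qed
  moreover have "norm (\<xi> y - L) \<le> e"
  proof -
    \<comment> \<open>Preimages of balls under a linear map are convex, so the mean stays as close
      to \<open>L\<close> as its summands.\<close>
    have "convex (\<xi> -` cball L (e/4))"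
      using \<xi> by (intro convex_linear_vimage) auto
    then have "y \<in> \<xi> -` cball L (e/4)"
      unfolding \<open>y = (\<Sum>i<n. (1 / real n) *\<^sub>R z i)\<close>
      using n0 z(2) by (intro convex_sum) (auto simp: dist_norm norm_minus_commute)
    then show ?thesis
      using e by (auto simp: dist_norm norm_minus_commute)
  qed
  ultimately show ?thesis
    using that by (simp add: R_def)
qed

text \<open>Here \<open>u\<close> plays the role of \<open>\<xi> y\<close>. The main terms cancel in
  the expanded square; two diagonal errors \<open>e\<close> and two cross errors
  \<open>2 * e\<close> remain.\<close>

lemma norm_diff_average_le:
  assumes "norm (ip y y - (1/2) *\<^sub>R (L + st L)) \<le> e" "norm (u - L) \<le> e"
    and "norm (ip y' y' - (1/2) *\<^sub>R (L + st L)) \<le> e" "norm (ip y' y - u) \<le> e"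
  shows "(norm (y - y'))\<^sup>2 \<le> 6 * e"
proof -
  define R where "R = (1/2) *\<^sub>R (L + st L)"
  have RR: "R + R = L + st L"
    by (simp add: R_def flip: scaleR_add_left)
  have L: "norm (ip y' y - L) \<le> 2 * e"
    using assms(2,4) norm_triangle_ineq[of "ip y' y - u" "u - L"] by simp
  have "ip (y - y') (y - y') = ip y y + ip y' y' - (ip y' y + ip y y')"
    by (simp add: diff_left diff_right)
  also have "\<dots> = (ip y y - R) + (ip y' y' - R) - ((ip y' y - L) + st (ip y' y - L))"
    using RR by (simp add: st.diff st_ip algebra_simps)
  also have "norm \<dots> \<le> norm ((ip y y - R) + (ip y' y' - R)) + norm ((ip y' y - L) + st (ip y' y - L))"
    by (rule norm_triangle_ineq4)
  also have "\<dots> \<le> (e + e) + (2 * e + 2 * e)"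
    using assms(1,3) L unfolding R_def by (intro add_mono norm_triangle_mono) (auto simp only: norm_st)
  finally show ?thesis
    by (simp add: norm_ip_self)
qed

theorem weak_limit_representable:
  assumes F: "F \<noteq> bot"
    and bdd: "\<And>\<alpha>. norm (xn \<alpha>) \<le> M"
    and \<xi>: "linear \<xi>"
    and weak: "\<And>x. ((\<lambda>\<alpha>. ip (xn \<alpha>) x) \<longlongrightarrow> \<xi> x) F"
    and lim: "((\<lambda>\<alpha>. \<xi> (xn \<alpha>)) \<longlongrightarrow> L) F"
  obtains \<eta> where "\<And>x. \<xi> x = ip \<eta> x"
proof -
  define Q where "Q e y \<longleftrightarrow> norm (ip y y - (1/2) *\<^sub>R (L + st L)) \<le> e \<and> norm (\<xi> y - L) \<le> e" for e y
  \<comment> \<open>For fixed \<open>x\<close> the bound on \<open>ip w x - \<xi> x\<close> cuts out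
    a convex set of \<open>w\<close>, so averages inherit it from a tail on which it holds for every
    \<open>x\<close> in the finite set \<open>X\<close>.\<close>
  have late: "\<exists>w. Q e w \<and> (\<forall>x\<in>X. norm (ip w x - \<xi> x) \<le> e)" if "e > 0" "finite X" for e X
  proof -
    have "eventually (\<lambda>\<alpha>. \<forall>x\<in>X. norm (ip (xn \<alpha>) x - \<xi> x) < e) F"
      using tendstoD[OF weak \<open>e > 0\<close>] \<open>finite X\<close>
      by (intro eventually_ball_finite) (auto simp: dist_norm)
    then obtain w where
      w: "w \<in> convex hull (xn ` {\<alpha>. \<forall>x\<in>X. norm (ip (xn \<alpha>) x - \<xi> x) < e})" "Q e w"
      using exists_average[OF F bdd \<xi> weak lim _ \<open>e > 0\<close>] unfolding Q_def by blast
    have "w \<in> (\<lambda>w. ip w x) -` cball (\<xi> x) e" if "x \<in> X" for x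
    proof -
      have "convex ((\<lambda>w. ip w x) -` cball (\<xi> x) e)"
        by (intro convex_linear_vimage bounded_linear.linear bounded_linear_left) auto
      then have "convex hull (xn ` {\<alpha>. \<forall>x\<in>X. norm (ip (xn \<alpha>) x - \<xi> x) < e})
                 \<subseteq> (\<lambda>w. ip w x) -` cball (\<xi> x) e"
        using that by (intro hull_minimal) (auto simp: dist_norm norm_minus_commute less_imp_le)
      then show ?thesis using w(1) by blast
    qed
    then show ?thesis
      using w(2) by (auto simp: dist_norm norm_minus_commute)
  qed
  have close: "norm (y - w) \<le> sqrt (6 * e)"
    if "Q e y" "Q e w" "norm (ip w y - \<xi> y) \<le> e" for e y w
    using norm_diff_average_le[of y L e "\<xi> y" w] that by (intro real_le_rsqrt) (auto simp: Q_def)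
  \<comment> \<open>Neither of \<open>y\<close>, \<open>y'\<close> need be late relative to the
    other; a third average, late relative to both, mediates.\<close>
  have all_close: "norm (y - y') \<le> 2 * sqrt (6 * e)" if "Q e y" "Q e y'" "e > 0" for e y y'
  proof -
    obtain w where w: "Q e w" "\<forall>x\<in>{y, y'}. norm (ip w x - \<xi> x) \<le> e"
      using late[OF \<open>e > 0\<close>, of "{y, y'}"] by auto
    have "norm (y - w) \<le> sqrt (6 * e)" "norm (y' - w) \<le> sqrt (6 * e)"
      using w that by (auto intro: close)
    then show ?thesis
      using norm_triangle_ineq4[of "y - w" "y' - w"] by simp
  qed
  define d where "d n = inverse (real (Suc n))" for n
  have d0: "d n > 0" for n by (simp add: d_def)
  have "\<exists>y. Q (d n) y" for n
    using late[OF d0, of "{}"] by auto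
  then obtain y where y: "\<And>n. Q (d n) (y n)" by metis
  have d_tendsto: "d \<longlonglongrightarrow> 0"
    unfolding d_def by (rule LIMSEQ_inverse_real_of_nat)
  have Q_mono: "Q e' w" if "Q e w" "e \<le> e'" for e e' w
    using that by (auto simp: Q_def)
  have s_tendsto: "(\<lambda>n. 2 * sqrt (6 * d n)) \<longlonglongrightarrow> 0"
    using tendsto_mult[OF tendsto_const[of 2]
        tendsto_real_sqrt[OF tendsto_mult[OF tendsto_const[of 6] d_tendsto]]] by simp
  have "Cauchy y"
  proof (rule metric_CauchyI)
    fix e :: real assume "e > 0"
    then obtain N where N: "2 * sqrt (6 * d N) < e"
      using order_tendstoD(2)[OF s_tendsto] unfolding eventually_sequentially by blast
    have "dist (y m) (y n) < e" if "m \<ge> N" "n \<ge> N" for m n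
    proof -
      have "d m \<le> d N" "d n \<le> d N"
        using that by (simp_all add: d_def)
      then show ?thesis
        using all_close[of "d N" "y m" "y n"] Q_mono y d0 N
        unfolding dist_norm by (meson le_less_trans)
    qed
    then show "\<exists>N. \<forall>m\<ge>N. \<forall>n\<ge>N. dist (y m) (y n) < e" by blast
  qed
  then obtain \<eta> where \<eta>: "y \<longlonglongrightarrow> \<eta>"
    using Cauchy_convergent convergent_def by blast
  have "\<xi> x = ip \<eta> x" for x
  proof -
    \<comment> \<open>The sequence \<open>y\<close> was chosen without regard to \<open>x\<close>.
      Averages \<open>w n\<close> adapted to \<open>x\<close> have the same limit, by
      \<open>all_close\<close>.\<close>
    have "\<exists>w. Q (d n) w \<and> norm (ip w x - \<xi> x) \<le> d n" for n
      using late[OF d0, of "{x}"] by auto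
    then obtain w where w: "\<And>n. Q (d n) (w n)" "\<And>n. norm (ip (w n) x - \<xi> x) \<le> d n" by metis
    have "(\<lambda>n. w n - y n) \<longlonglongrightarrow> 0"
      by (rule Lim_null_comparison[OF _ s_tendsto]) (intro always_eventually allI all_close w y d0)
    from tendsto_add[OF this \<eta>] have "w \<longlonglongrightarrow> \<eta>" by simp
    then have "(\<lambda>n. ip (w n) x) \<longlonglongrightarrow> ip \<eta> x"
      by (intro tendsto tendsto_const)
    moreover have "(\<lambda>n. ip (w n) x - \<xi> x) \<longlonglongrightarrow> 0"
      by (rule Lim_null_comparison[OF _ d_tendsto]) (intro always_eventually allI w)
    then have "(\<lambda>n. ip (w n) x) \<longlonglongrightarrow> \<xi> x"
      by (rule LIM_zero_cancel)
    ultimately show ?thesis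
      using LIMSEQ_unique by blast
  qed
  then show ?thesis by (rule that)
qed

end

section \<open>Nontriviality of the net filter and boundedness of the inner product\<close>

lemma net_filter_neq_bot:
  assumes "directed TYPE('i::preorder)"
  shows "(net_filter :: 'i filter) \<noteq> bot"
proof -
  have "(INF k\<in>(UNIV :: 'i set). principal {j. k \<le> j}) = bot
        \<longleftrightarrow> (\<exists>k\<in>(UNIV :: 'i set). principal {j. k \<le> j} = bot)"
  proof (rule INF_filter_bot_base)
    fix a b :: 'i
    obtain c where "a \<le> c" "b \<le> c"
      using assms by (auto simp: directed_def)
    then show "\<exists>k\<in>UNIV. principal {j. k \<le> j} \<le> inf (principal {j. a \<le> j}) (principal {j. b \<le> j})"
      by (auto intro!: exI[of _ c] intro: order_trans)
  qed
  then show ?thesis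
    by (auto simp: net_filter_def principal_eq_bot_iff)
qed

lemma cstar_norm_star:
  assumes "cstar_algebra sc st"
  shows "norm (st a) = norm a"
proof -
  have le: "norm a \<le> norm (st a)" for a
  proof (cases "a = 0")
    case False
    have "norm a * norm a = norm (st a * a)"
      using assms by (simp add: cstar_algebra_def power2_eq_square)
    also have "\<dots> \<le> norm (st a) * norm a" by (rule norm_mult_ineq)
    finally show ?thesis using False by simp
  qed simp
  have "st (st a) = a" using assms by (simp add: cstar_algebra_def)
  then show ?thesis using le[of a] le[of "st a"] by simp
qed

text \<open>Properties of the first argument of \<open>ip\<close> follow from those of the second by
  applying \<open>st\<close>; the boundedness of \<open>ip\<close> is reduced to unit vectors by
  scaling.\<close>

lemma hilbert_module_hermitian_form:
  assumes "hilbert_module sc st scH ra ip"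
  shows "hermitian_form ip st"
proof -
  have A: "cstar_algebra sc st"
    using assms by (simp add: hilbert_module_def)
  have sc_real: "sc (complex_of_real r) a = r *\<^sub>R a" and sc_norm: "norm (sc c a) = cmod c * norm a"
    and sc_add: "sc c (a + b) = sc c a + sc c b"
    and sc_mult: "sc (c * d) a = sc c (sc d a)"
    and st_add: "st (a + b) = st a + st b" and st_sc: "st (sc c a) = sc (cnj c) (st a)"
    for r c d a b
    using A by (simp_all add: cstar_algebra_def)
  have scH_real: "scH (complex_of_real r) x = r *\<^sub>R x"
    and ip_add: "ip x (y + z) = ip x y + ip x z"
    and ip_scH: "ip x (scH c y) = sc c (ip x y)"
    and st_ip: "st (ip x y) = ip y x"
    and norm_x: "norm x = sqrt (norm (ip x x))"
    for r x y z c
    using assms by (simp_all add: hilbert_module_def)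
  have norm_ip: "norm (ip x x) = (norm x)\<^sup>2" for x
    by (simp add: norm_x)
  have norm_st: "norm (st a) = norm a" for a
    using A by (rule cstar_norm_star)
  have st_scaleR: "st (r *\<^sub>R a) = r *\<^sub>R st a" for r a
    using st_sc[of "complex_of_real r" a] by (simp add: sc_real)
  have ip_add': "ip (x + y) z = ip x z + ip y z" for x y z
    by (metis ip_add st_add st_ip)
  have ip_scaleR: "ip x (r *\<^sub>R y) = r *\<^sub>R ip x y" for x y r
    using ip_scH[of x "complex_of_real r" y] by (simp add: scH_real sc_real)
  have ip_scaleR': "ip (r *\<^sub>R x) y = r *\<^sub>R ip x y" for x y r
    by (metis ip_scaleR st_scaleR st_ip)
  have ip_scH': "ip (scH c x) y = sc (cnj c) (ip x y)" for c x y
    by (metis ip_scH st_sc st_ip)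
  have norm_i: "norm (scH \<i> x) = norm x" for x
    by (simp add: norm_x[of "scH \<i> x"] norm_x[of x] ip_scH ip_scH' sc_norm)
  \<comment> \<open>Polarization replaces the Cauchy--Schwarz inequality; the constant 6 is not sharp.\<close>
  have sym: "norm (ip x y + ip y x) \<le> 6" if "norm x = 1" "norm y = 1" for x y
  proof -
    have "norm (x + y) \<le> 2"
      using norm_triangle_ineq[of x y] that by simp
    then have "(norm (x + y))\<^sup>2 \<le> 4"
      using power_mono[of "norm (x + y)" 2 2] by simp
    moreover have "ip x y + ip y x = ip (x + y) (x + y) - (ip x x + ip y y)"
      by (simp add: ip_add ip_add')
    then have "norm (ip x y + ip y x) \<le> (norm (x + y))\<^sup>2 + ((norm x)\<^sup>2 + (norm y)\<^sup>2)"
      unfolding norm_ip[symmetric]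
      by (metis norm_triangle_ineq norm_triangle_le_diff add_left_mono)
    ultimately show ?thesis using that by simp
  qed
  have unit: "norm (ip x y) \<le> 6" if "norm x = 1" "norm y = 1" for x y
  proof -
    have minus: "sc (- 1) a = - a" for a
      using sc_real[of "-1" a] by simp
    have one: "sc 1 a = a" for a
      using sc_real[of 1 a] by simp
    \<comment> \<open>Replacing \<open>y\<close> by the unit vector \<open>scH \<i> y\<close> turns
      the symmetric bound into one for the antisymmetric part.\<close>
    have "sc (- \<i>) (ip x (scH \<i> y) + ip (scH \<i> y) x) = ip x y - ip y x"
      by (simp add: ip_scH ip_scH' sc_add one minus flip: sc_mult)
    then have "2 *\<^sub>R ip x y = (ip x y + ip y x) + sc (- \<i>) (ip x (scH \<i> y) + ip (scH \<i> y) x)"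
      by (simp add: scaleR_2)
    also have "norm \<dots> \<le> 6 + 6"
      using that by (intro norm_triangle_mono) (auto simp: sc_norm norm_i intro!: sym)
    finally show ?thesis by simp
  qed
  have bound: "norm (ip x y) \<le> norm x * norm y * 6" for x y
  proof (cases "x = 0 \<or> y = 0")
    case True
    then show ?thesis
      using ip_scaleR[of x 0 y] ip_scaleR'[of 0 x y] by auto
  next
    case False
    then have "ip x y = (norm x * norm y) *\<^sub>R ip (sgn x) (sgn y)"
      by (simp add: sgn_div_norm ip_scaleR ip_scaleR' field_simps)
    moreover have "norm (ip (sgn x) (sgn y)) \<le> 6"
      using False by (intro unit) (auto simp: norm_sgn)
    ultimately show ?thesis
      by (simp add: mult_left_mono)
  qed
  show ?thesis
  proof
    show "\<exists>K. \<forall>a b. norm (ip a b) \<le> norm a * norm b * K"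
      using bound by blast
    show "\<exists>K. \<forall>x. norm (st x) \<le> norm x * K"
      by (intro exI[of _ 1]) (simp add: norm_st)
  qed (simp_all add: ip_add ip_add' ip_scaleR ip_scaleR' st_add st_scaleR norm_st st_ip norm_ip)
qed

theorem theorem5p5:
  fixes sc :: "complex \<Rightarrow> 'a::{real_normed_algebra,banach} \<Rightarrow> 'a"
    and st :: "'a \<Rightarrow> 'a"
    and scH :: "complex \<Rightarrow> 'h::banach \<Rightarrow> 'h"
    and ra :: "'h \<Rightarrow> 'a \<Rightarrow> 'h"
    and ip :: "'h \<Rightarrow> 'h \<Rightarrow> 'a"
    and \<xi> :: "'h \<Rightarrow> 'a"
    and xn :: "'i::preorder \<Rightarrow> 'h"
  assumes "hilbert_module sc st scH ra ip"
    and "hilbert_sharp sc scH ra \<xi>"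
    and "directed TYPE('i)"
    and "\<exists>M. \<forall>\<alpha>. norm (xn \<alpha>) \<le> M"
    and "\<forall>x. ((\<lambda>\<alpha>. norm (\<xi> x - ip (xn \<alpha>) x)) \<longlongrightarrow> 0) net_filter"
    and "\<exists>L. ((\<lambda>\<alpha>. \<xi> (xn \<alpha>)) \<longlongrightarrow> L) net_filter"
  shows "\<exists>\<eta>. (\<forall>x. \<xi> x = ip \<eta> x) \<and> ((\<lambda>\<alpha>. \<xi> (xn \<alpha>)) \<longlongrightarrow> ip \<eta> \<eta>) net_filter"
proof -
  interpret hermitian_form ip st
    using assms(1) by (rule hilbert_module_hermitian_form)
  have weak: "((\<lambda>\<alpha>. ip (xn \<alpha>) x) \<longlongrightarrow> \<xi> x) net_filter" for x
    using assms(5) by (subst tendsto_dist_iff) (simp add: dist_norm norm_minus_commute)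
  have "\<xi> (r *\<^sub>R x) = r *\<^sub>R \<xi> x" for r x
  proof -
    have "\<xi> (scH (complex_of_real r) x) = sc (complex_of_real r) (\<xi> x)"
      using assms(2) by (simp add: hilbert_sharp_def)
    then show ?thesis
      using assms(1) by (simp add: hilbert_module_def cstar_algebra_def)
  qed
  then have lin: "linear \<xi>"
    using assms(2) by (intro linearI) (simp_all add: hilbert_sharp_def)
  obtain M L where "\<And>\<alpha>. norm (xn \<alpha>) \<le> M" and L: "((\<lambda>\<alpha>. \<xi> (xn \<alpha>)) \<longlongrightarrow> L) net_filter"
    using assms(4,6) by blast
  from weak_limit_representable[OF net_filter_neq_bot[OF assms(3)] this(1) lin weak L]
  obtain \<eta> where \<eta>: "\<And>x. \<xi> x = ip \<eta> x" by blast
  \<comment> \<open>Weak convergence tested at \<open>\<eta>\<close> itself: by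
    \<open>st_ip\<close>, the adjoint of \<open>ip (xn \<alpha>) \<eta>\<close> is
    \<open>\<xi> (xn \<alpha>)\<close>, and \<open>\<xi> \<eta>\<close> is self-adjoint.\<close>
  have "((\<lambda>\<alpha>. st (ip (xn \<alpha>) \<eta>)) \<longlongrightarrow> st (\<xi> \<eta>)) net_filter"
    by (intro st.tendsto weak)
  then have "((\<lambda>\<alpha>. \<xi> (xn \<alpha>)) \<longlongrightarrow> ip \<eta> \<eta>) net_filter"
    by (simp add: \<eta> st_ip)
  then show ?thesis using \<eta> by blast
qed

end
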